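(* The Révész-Sarantopoulos Conjecture and Baran's Conjecture (both stated in the context) cannot both be true.
   Context: Révész-Sarantopoulos Conjecture: let $X$ be a real normed space and $K\subset X$ a convex body (bounded closed convex set with nonempty interior). For every $x\in\operatorname{int}K$, every $n$, and every continuous polynomial $p$ of degree at most $n$ on $X$, $$\|Dp(x)\|\le\frac{2n\sqrt{\|p\|_{C(K)}^2-p(x)^2}}{w(K)\sqrt{1-\alpha^2(K,x)}}.$$ Here $\|p\|_{C(K)}=\sup_K|p|$, $\|Dp(x)\|$ is the operator norm of the derivative, $w(K)=\inf\{\sup_{u,v\in K}\langle v^*,u-v\rangle : v^*\in X^*,\ \|v^*\|=1\}$ is the minimal width, and $\alpha(K,x)=\sqrt{1-\gamma^2(K,x)}$ is the generalized Minkowski functional, where $$\gamma(K,x)=\inf\Big\{\frac{2\sqrt{\|x-a\|\,\|x-b\|}}{\|a-b\|} : a,b\in\partial K,\ x\in[a,b]\Big\}.$$ Baran's Conjecture: for every $d$ and every non-symmetric convex body $E\subset\mathbb{R}^d$, $\frac1{d!}\lambda_E(x)=\operatorname{vol}\operatorname{con}G(E,x)$ for all $x\in\operatorname{int}E$. Here $\operatorname{con}$ denotes the closed convex hull and $$G(E,x)=\Big\{\frac{\operatorname{grad}p(x)}{n\sqrt{\|p\|_E^2-p(x)^2}} : n\in\mathbb{N},\ 0\ne p \text{ a real polynomial on } \mathbb{R}^d \text{ of degree at most } n\Big\},$$ with $\|p\|_E=\max_E|p|$ and $0/0$ interpreted as $0$. The function $\lambda_E$ is the density on $\operatorname{int}E$,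 with respect to Lebesgue measure of $\mathbb{R}^d$, of the complex equilibrium measure of $E$ (the continuous representative where one exists, as is the case for the standard simplex). The complex equilibrium measure is the Monge-Ampère measure $(\partial\overline\partial V_E)^d$ in the sense of Bedford-Taylor, normalized so that for $C^2$ plurisubharmonic $u$, $(\partial\overline\partial u)^d=d!\,4^d\det\big[\frac{\partial^2u}{\partial z_j\partial\overline z_k}\big]dV$ with $dV$ Lebesgue measure on $\mathbb{C}^d$ (total mass $(2\pi)^d$), and $V_E$ is the Zaharjuta-Siciak extremal function: $V_E=0$ on $E$ and $V_E(z)=\sup\{\frac1n\log|p(z)| : n\in\mathbb{N},\ 0\ne p\text{ a polynomial on }\mathbb{C}^d\text{ of degree at most }n,\ \|p\|_E\le1\}$ for $z\notin E$. *)

theory Defs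
  imports "HOL-Analysis.Analysis"
begin

section \<open>Normed spaces carried by subspaces of a real vector space\<close>

text \<open>
  HOL has no quantification over types inside a formula, so a real normed space is a pair
  \<open>(V, N)\<close> of a linear subspace \<open>V\<close> of an ambient type \<open>'v\<close> and an arbitrary norm \<open>N\<close> on \<open>V\<close>;
  the values of \<open>N\<close> off \<open>V\<close> are irrelevant.
\<close>

definition normed_space_on :: "'v::real_vector set \<Rightarrow> ('v \<Rightarrow> real) \<Rightarrow> bool" where
  "normed_space_on V N \<longleftrightarrow>
     subspace V \<and>
     (\<forall>x\<in>V. 0 \<le> N x \<and> (N x = 0 \<longleftrightarrow> x = 0)) \<and>
     (\<forall>c. \<forall>x\<in>V. N (c *\<^sub>R x) = \<bar>c\<bar> * N x) \<and>
     (\<forall>x\<in>V. \<forall>y\<in>V. N (x + y) \<le> N x + N y)"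

text \<open>
  The locale \<open>Metric_space\<close> wants symmetry and nonnegativity on the whole type, whence the
  default value off \<open>V\<close>.
\<close>

definition norm_topology :: "'v::real_vector set \<Rightarrow> ('v \<Rightarrow> real) \<Rightarrow> 'v topology" where
  "norm_topology V N =
     Metric_space.mtopology V (\<lambda>x y. if x \<in> V \<and> y \<in> V then N (x - y) else 0)"

definition convex_body_on :: "'v::real_vector set \<Rightarrow> ('v \<Rightarrow> real) \<Rightarrow> 'v set \<Rightarrow> bool" where
  "convex_body_on V N K \<longleftrightarrow>
     (\<exists>B. \<forall>x\<in>K. N x \<le> B) \<and> closedin (norm_topology V N) K \<and> convex K \<and>
     norm_topology V N interior_of K \<noteq> {}"

definition continuous_functional :: "'v::real_vector set \<Rightarrow> ('v \<Rightarrow> real) \<Rightarrow> ('v \<Rightarrow> real) \<Rightarrow> bool" where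
  "continuous_functional V N f \<longleftrightarrow>
     (\<forall>x\<in>V. \<forall>y\<in>V. f (x + y) = f x + f y) \<and>
     (\<forall>c. \<forall>x\<in>V. f (c *\<^sub>R x) = c * f x) \<and>
     (\<exists>B. \<forall>x\<in>V. \<bar>f x\<bar> \<le> B * N x)"

definition functional_norm :: "'v::real_vector set \<Rightarrow> ('v \<Rightarrow> real) \<Rightarrow> ('v \<Rightarrow> real) \<Rightarrow> real" where
  "functional_norm V N f = (SUP x\<in>{x\<in>V. N x \<le> 1}. \<bar>f x\<bar>)"

text \<open>
  A \<open>k\<close>-linear form on \<open>V\<close> takes its arguments as a function on \<open>{..<k}\<close>; extensionality of the
  argument ensures that nothing but the \<open>k\<close> vectors enters.
\<close>

definition multilinear_on :: "'v::real_vector set \<Rightarrow> nat \<Rightarrow> ((nat \<Rightarrow> 'v) \<Rightarrow> real) \<Rightarrow> bool" where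
  "multilinear_on V k L \<longleftrightarrow>
     (\<forall>m \<in> {..<k} \<rightarrow>\<^sub>E V. \<forall>i<k.
        (\<forall>x\<in>V. \<forall>y\<in>V. L (m(i := x + y)) = L (m(i := x)) + L (m(i := y))) \<and>
        (\<forall>c. \<forall>x\<in>V. L (m(i := c *\<^sub>R x)) = c * L (m(i := x))))"

definition continuous_polynomial ::
    "'v::real_vector set \<Rightarrow> ('v \<Rightarrow> real) \<Rightarrow> nat \<Rightarrow> ('v \<Rightarrow> real) \<Rightarrow> bool" where
  "continuous_polynomial V N n p \<longleftrightarrow>
     continuous_map (norm_topology V N) euclideanreal p \<and>
     (\<exists>L. (\<forall>k\<le>n. multilinear_on V k (L k)) \<and>
          (\<forall>x\<in>V. p x = (\<Sum>k\<le>n. L k (\<lambda>i\<in>{..<k}. x))))"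

definition frechet_derivative_on ::
    "'v::real_vector set \<Rightarrow> ('v \<Rightarrow> real) \<Rightarrow> ('v \<Rightarrow> real) \<Rightarrow> 'v \<Rightarrow> ('v \<Rightarrow> real) \<Rightarrow> bool" where
  "frechet_derivative_on V N p x D \<longleftrightarrow>
     continuous_functional V N D \<and>
     (\<forall>e>0. \<exists>\<delta>>0. \<forall>h\<in>V. N h < \<delta> \<longrightarrow> \<bar>p (x + h) - p x - D h\<bar> \<le> e * N h)"

definition sup_abs :: "'a set \<Rightarrow> ('a \<Rightarrow> real) \<Rightarrow> real" where
  "sup_abs K p = (SUP x\<in>K. \<bar>p x\<bar>)"

definition minimal_width :: "'v::real_vector set \<Rightarrow> ('v \<Rightarrow> real) \<Rightarrow> 'v set \<Rightarrow> real" where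
  "minimal_width V N K =
     Inf {SUP (u, v)\<in>K \<times> K. f (u - v) | f.
            continuous_functional V N f \<and> functional_norm V N f = 1}"

definition gamma_body :: "'v::real_vector set \<Rightarrow> ('v \<Rightarrow> real) \<Rightarrow> 'v set \<Rightarrow> 'v \<Rightarrow> real" where
  "gamma_body V N K x =
     Inf {2 * sqrt (N (x - a) * N (x - b)) / N (a - b) | a b.
            a \<in> norm_topology V N frontier_of K \<and> b \<in> norm_topology V N frontier_of K \<and>
            x \<in> closed_segment a b}"

definition minkowski_functional :: "'v::real_vector set \<Rightarrow> ('v \<Rightarrow> real) \<Rightarrow> 'v set \<Rightarrow> 'v \<Rightarrow> real" where
  "minkowski_functional V N K x = sqrt (1 - (gamma_body V N K x)\<^sup>2)"

definition revesz_sarantopoulos_conjecture :: "'v::real_vector itself \<Rightarrow> bool" where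
  "revesz_sarantopoulos_conjecture T \<longleftrightarrow>
     (\<forall>(V::'v set) N K x n p D.
        normed_space_on V N \<longrightarrow> convex_body_on V N K \<longrightarrow>
        x \<in> norm_topology V N interior_of K \<longrightarrow>
        continuous_polynomial V N n p \<longrightarrow> frechet_derivative_on V N p x D \<longrightarrow>
        functional_norm V N D \<le>
          2 * real n * sqrt ((sup_abs K p)\<^sup>2 - (p x)\<^sup>2) /
          (minimal_width V N K * sqrt (1 - (minkowski_functional V N K x)\<^sup>2)))"


section \<open>The spaces \<open>\<real>\<^sup>d\<close> and \<open>\<complex>\<^sup>d\<close> for variable \<open>d\<close>\<close>

text \<open>
  Vectors are extensional functions on \<open>{..<d}\<close>, so that the product topology and the product
  of the measures \<open>lborel\<close> apply.
\<close>

definition coord_space :: "nat \<Rightarrow> (nat \<Rightarrow> 'a) set" where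
  "coord_space d = {..<d} \<rightarrow>\<^sub>E UNIV"

definition coord_topology :: "nat \<Rightarrow> (nat \<Rightarrow> 'a::topological_space) topology" where
  "coord_topology d = product_topology (\<lambda>_. euclidean) {..<d}"

definition coord_lebesgue :: "nat \<Rightarrow> (nat \<Rightarrow> 'a::euclidean_space) measure" where
  "coord_lebesgue d = PiM {..<d} (\<lambda>_. lborel)"

definition coord_convex :: "nat \<Rightarrow> (nat \<Rightarrow> real) set \<Rightarrow> bool" where
  "coord_convex d S \<longleftrightarrow>
     (\<forall>x\<in>S. \<forall>y\<in>S. \<forall>t\<in>{0..1}. (\<lambda>i\<in>{..<d}. (1 - t) * x i + t * y i) \<in> S)"

definition closed_convex_hull :: "nat \<Rightarrow> (nat \<Rightarrow> real) set \<Rightarrow> (nat \<Rightarrow> real) set" where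
  "closed_convex_hull d S =
     \<Inter>{C. closedin (coord_topology d) C \<and> coord_convex d C \<and> S \<subseteq> C}"

text \<open>Closed and bounded sets in \<open>\<real>\<^sup>d\<close> are expressed as compact ones.\<close>

definition coord_convex_body :: "nat \<Rightarrow> (nat \<Rightarrow> real) set \<Rightarrow> bool" where
  "coord_convex_body d E \<longleftrightarrow>
     compactin (coord_topology d) E \<and> coord_convex d E \<and>
     coord_topology d interior_of E \<noteq> {}"

definition coord_symmetric :: "nat \<Rightarrow> (nat \<Rightarrow> real) set \<Rightarrow> bool" where
  "coord_symmetric d E \<longleftrightarrow>
     (\<exists>c\<in>coord_space d. \<forall>x\<in>E. (\<lambda>i\<in>{..<d}. 2 * c i - x i) \<in> E)"

definition coord_polys :: "nat \<Rightarrow> nat \<Rightarrow> ((nat \<Rightarrow> 'a::comm_ring_1) \<Rightarrow> 'a) set" where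
  "coord_polys d n =
     {\<lambda>z. \<Sum>\<alpha>\<in>{\<alpha> \<in> {..<d} \<rightarrow>\<^sub>E {..n}. (\<Sum>i<d. \<alpha> i) \<le> n}. c \<alpha> * (\<Prod>i<d. z i ^ \<alpha> i) | c. True}"

definition grad :: "nat \<Rightarrow> ((nat \<Rightarrow> real) \<Rightarrow> real) \<Rightarrow> (nat \<Rightarrow> real) \<Rightarrow> (nat \<Rightarrow> real)" where
  "grad d p x = (\<lambda>j\<in>{..<d}. deriv (\<lambda>t. p (x(j := t))) (x j))"

definition to_complex :: "nat \<Rightarrow> (nat \<Rightarrow> real) \<Rightarrow> (nat \<Rightarrow> complex)" where
  "to_complex d x = (\<lambda>i\<in>{..<d}. complex_of_real (x i))"

text \<open>Division by zero in HOL yields \<open>0\<close>, which is the convention needed for \<open>0/0\<close> below.\<close>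

definition gradient_set :: "nat \<Rightarrow> (nat \<Rightarrow> real) set \<Rightarrow> (nat \<Rightarrow> real) \<Rightarrow> (nat \<Rightarrow> real) set" where
  "gradient_set d E x =
     {\<lambda>j\<in>{..<d}. grad d p x j / (real n * sqrt ((sup_abs E p)\<^sup>2 - (p x)\<^sup>2)) | n p.
        1 \<le> n \<and> p \<in> coord_polys d n \<and> p \<noteq> (\<lambda>_. 0)}"


section \<open>The Monge-Ampere operator of Bedford and Taylor\<close>

definition real_partial ::
    "nat \<Rightarrow> complex \<Rightarrow> ((nat \<Rightarrow> complex) \<Rightarrow> complex) \<Rightarrow> (nat \<Rightarrow> complex) \<Rightarrow> complex" where
  "real_partial j c f z = vector_derivative (\<lambda>t::real. f (z(j := z j + of_real t * c))) (at 0)"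

primrec C_k :: "nat \<Rightarrow> nat \<Rightarrow> ((nat \<Rightarrow> complex) \<Rightarrow> complex) \<Rightarrow> bool" where
  "C_k d 0 f \<longleftrightarrow> continuous_map (coord_topology d) euclidean f"
| "C_k d (Suc k) f \<longleftrightarrow>
     continuous_map (coord_topology d) euclidean f \<and>
     (\<forall>j<d. \<forall>c\<in>{1, \<i>}.
        (\<forall>z\<in>coord_space d. (\<lambda>t::real. f (z(j := z j + of_real t * c))) differentiable (at 0)) \<and>
        C_k d k (real_partial j c f))"

definition test_function :: "nat \<Rightarrow> ((nat \<Rightarrow> complex) \<Rightarrow> complex) \<Rightarrow> bool" where
  "test_function d \<phi> \<longleftrightarrow>
     (\<forall>k. C_k d k \<phi>) \<and>
     (\<exists>C. compactin (coord_topology d) C \<and> (\<forall>z\<in>coord_space d - C. \<phi> z = 0))"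

definition wirtinger ::
    "nat \<Rightarrow> ((nat \<Rightarrow> complex) \<Rightarrow> complex) \<Rightarrow> (nat \<Rightarrow> complex) \<Rightarrow> complex" where
  "wirtinger j f z = (real_partial j 1 f z - \<i> * real_partial j \<i> f z) / 2"

definition wirtinger_bar ::
    "nat \<Rightarrow> ((nat \<Rightarrow> complex) \<Rightarrow> complex) \<Rightarrow> (nat \<Rightarrow> complex) \<Rightarrow> complex" where
  "wirtinger_bar j f z = (real_partial j 1 f z + \<i> * real_partial j \<i> f z) / 2"

definition radon_measure :: "nat \<Rightarrow> (nat \<Rightarrow> complex) measure \<Rightarrow> bool" where
  "radon_measure d \<mu> \<longleftrightarrow>
     sets \<mu> = sets (coord_lebesgue d) \<and>
     (\<forall>C. compactin (coord_topology d) C \<longrightarrow> emeasure \<mu> C < \<infinity>)"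

definition multi_index :: "nat \<Rightarrow> nat \<Rightarrow> nat list \<Rightarrow> bool" where
  "multi_index d k a \<longleftrightarrow> length a = k \<and> sorted_wrt (<) a \<and> set a \<subseteq> {..<d}"

definition remove_nth :: "nat \<Rightarrow> 'a list \<Rightarrow> 'a list" where
  "remove_nth i xs = take i xs @ drop (Suc i) xs"

text \<open>
  For a locally bounded plurisubharmonic \<open>u\<close>, the currents \<open>T\<^sub>0 = 1\<close> and
  \<open>T\<^sub>k\<^sub>+\<^sub>1 = \<partial>\<partial>\<^sup>-(u T\<^sub>k)\<close> have measure coefficients, and \<open>T\<^sub>d = (\<partial>\<partial>\<^sup>-u)\<^sup>d\<close>.  Write
  \<open>T\<^sub>k = \<Sum> T\<^sub>k(a,b) dz\<^bsub>a!0\<^esub> \<and> dz\<^sup>-\<^bsub>b!0\<^esub> \<and> \<dots> \<and> dz\<^bsub>a!(k-1)\<^esub> \<and> dz\<^sup>-\<^bsub>b!(k-1)\<^esub>\<close>, the sum ranging over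
  increasing multi-indices \<open>a\<close>, \<open>b\<close>.  The complex measure \<open>T\<^sub>k(a,b)\<close> is represented as
  \<open>H k a b\<close> times the positive measure \<open>M k\<close> with \<open>\<bar>H k a b\<bar> \<le> 1\<close>, and comparing coefficients in
  the recursion gives
  \<open>T\<^sub>k\<^sub>+\<^sub>1(a,b) = \<Sum>\<^bsub>i,j\<le>k\<^esub> (-1)\<^bsup>i+j\<^esup> \<partial>\<^bsub>a!i\<^esub> \<partial>\<^sup>-\<^bsub>b!j\<^esub> (u T\<^sub>k(a - a!i, b - b!j))\<close>
  in the sense of distributions.  If \<open>u\<close> is \<open>C\<^sup>2\<close>, Laplace expansion yields
  \<open>T\<^sub>k(a,b) = k! det (\<partial>\<^sup>2u / \<partial>z\<^bsub>a!i\<^esub>\<partial>z\<^sup>-\<^bsub>b!j\<^esub>) dV\<close>.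
\<close>

definition bedford_taylor_currents ::
    "nat \<Rightarrow> ((nat \<Rightarrow> complex) \<Rightarrow> real) \<Rightarrow> (nat \<Rightarrow> (nat \<Rightarrow> complex) measure) \<Rightarrow>
     (nat \<Rightarrow> nat list \<Rightarrow> nat list \<Rightarrow> (nat \<Rightarrow> complex) \<Rightarrow> complex) \<Rightarrow> bool" where
  "bedford_taylor_currents d u M H \<longleftrightarrow>
     M 0 = coord_lebesgue d \<and> H 0 [] [] = (\<lambda>_. 1) \<and>
     (\<forall>k\<le>d. radon_measure d (M k) \<and>
        (\<forall>a b. multi_index d k a \<longrightarrow> multi_index d k b \<longrightarrow>
           H k a b \<in> borel_measurable (M k) \<and> (\<forall>z\<in>coord_space d. cmod (H k a b z) \<le> 1))) \<and>
     (\<forall>k<d. \<forall>a b \<phi>.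
        multi_index d (Suc k) a \<longrightarrow> multi_index d (Suc k) b \<longrightarrow> test_function d \<phi> \<longrightarrow>
        (\<integral>z. \<phi> z * H (Suc k) a b z \<partial>M (Suc k)) =
        (\<Sum>i\<le>k. \<Sum>j\<le>k. (-1) ^ (i + j) *
           (\<integral>z. complex_of_real (u z) * wirtinger (a ! i) (wirtinger_bar (b ! j) \<phi>) z *
                 H k (remove_nth i a) (remove_nth j b) z \<partial>M k)))"

text \<open>
  The factor \<open>4\<^sup>d\<close> turns \<open>T\<^sub>d([0..<d],[0..<d]) = d! det (\<partial>\<^sup>2u / \<partial>z\<^sub>j\<partial>z\<^sup>-\<^sub>k) dV\<close> into
  \<open>d! 4\<^sup>d det (\<partial>\<^sup>2u / \<partial>z\<^sub>j\<partial>z\<^sup>-\<^sub>k) dV\<close>.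
\<close>

definition monge_ampere :: "nat \<Rightarrow> ((nat \<Rightarrow> complex) \<Rightarrow> real) \<Rightarrow> (nat \<Rightarrow> complex) measure" where
  "monge_ampere d u =
     (THE \<mu>. radon_measure d \<mu> \<and>
        (\<exists>M H. bedford_taylor_currents d u M H \<and>
           (\<forall>\<phi>. test_function d \<phi> \<longrightarrow>
              (\<integral>z. \<phi> z \<partial>\<mu>) = 4 ^ d * (\<integral>z. \<phi> z * H d [0..<d] [0..<d] z \<partial>M d))))"


section \<open>Equilibrium measure and Baran's conjecture\<close>

text \<open>
  Polynomials vanishing at \<open>z\<close> contribute \<open>-\<infinity>\<close> to the supremum and are left out, because
  \<open>ln 0 = 0\<close> in HOL.
\<close>

definition extremal_function :: "nat \<Rightarrow> (nat \<Rightarrow> real) set \<Rightarrow> (nat \<Rightarrow> complex) \<Rightarrow> real" where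
  "extremal_function d E z =
     (if z \<in> to_complex d ` E then 0
      else Sup {ln (cmod (p z)) / real n | n p.
             1 \<le> n \<and> p \<in> coord_polys d n \<and> (\<forall>x\<in>E. cmod (p (to_complex d x)) \<le> 1) \<and> p z \<noteq> 0})"

definition equilibrium_measure :: "nat \<Rightarrow> (nat \<Rightarrow> real) set \<Rightarrow> (nat \<Rightarrow> complex) measure" where
  "equilibrium_measure d E = monge_ampere d (extremal_function d E)"

definition is_equilibrium_density ::
    "nat \<Rightarrow> (nat \<Rightarrow> real) set \<Rightarrow> ((nat \<Rightarrow> real) \<Rightarrow> real) \<Rightarrow> bool" where
  "is_equilibrium_density d E l \<longleftrightarrow>
     (\<forall>x\<in>coord_topology d interior_of E. 0 \<le> l x) \<and>
     l \<in> borel_measurable (restrict_space (coord_lebesgue d) (coord_topology d interior_of E)) \<and>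
     (\<forall>A\<in>sets (coord_lebesgue d). A \<subseteq> coord_topology d interior_of E \<longrightarrow>
        emeasure (equilibrium_measure d E) (to_complex d ` A) =
        (\<integral>\<^sup>+x\<in>A. ennreal (l x) \<partial>coord_lebesgue d))"

definition continuous_on_interior ::
    "nat \<Rightarrow> (nat \<Rightarrow> real) set \<Rightarrow> ((nat \<Rightarrow> real) \<Rightarrow> real) \<Rightarrow> bool" where
  "continuous_on_interior d E l \<longleftrightarrow>
     continuous_map (subtopology (coord_topology d) (coord_topology d interior_of E)) euclideanreal l"

text \<open>
  A density is determined only almost everywhere; the continuous one, unique on the interior of
  \<open>E\<close>, is taken whenever there is one.
\<close>

definition equilibrium_density :: "nat \<Rightarrow> (nat \<Rightarrow> real) set \<Rightarrow> (nat \<Rightarrow> real) \<Rightarrow> real" where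
  "equilibrium_density d E =
     (SOME l. is_equilibrium_density d E l \<and>
        ((\<exists>l'. is_equilibrium_density d E l' \<and> continuous_on_interior d E l') \<longrightarrow>
         continuous_on_interior d E l))"

definition baran_conjecture :: bool where
  "baran_conjecture \<longleftrightarrow>
     (\<forall>d\<ge>1. \<forall>E. coord_convex_body d E \<longrightarrow> \<not> coord_symmetric d E \<longrightarrow>
        (\<forall>x\<in>coord_topology d interior_of E.
           ennreal (1 / fact d * equilibrium_density d E x) =
           emeasure (coord_lebesgue d) (closed_convex_hull d (gradient_set d E x))))"

end

theory Submission
  imports Defs
begin

text \<open>
  The Revesz-Sarantopoulos Conjecture alone already fails, for a quadratic polynomial on a
  triangle.  In the plane let \<open>K\<close> be the triangle \<open>s, t \<ge> 0\<close>, \<open>s + t \<le> 1\<close> and take the norm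
  whose unit ball is \<open>K - K\<close>, so that \<open>w(K) = 1\<close>.  At \<open>x = (1/10, 1/10)\<close> the smallest
  barycentric coordinate is \<open>1/10\<close>, hence \<open>\<gamma>(K,x) \<ge> 2 \<surd>(1/10 \<cdot> 9/10) = 3/5\<close>.  The polynomial
  \<open>p(s,t) = (s - t) (24 - 29 (s + t))\<close> vanishes at \<open>x\<close> and satisfies \<open>\<bar>p\<bar> \<le> 5\<close> on \<open>K\<close>, so the
  conjecture would give \<open>\<parallel>Dp(x)\<parallel> \<le> 4 \<cdot> 5 / (3/5) = 100/3\<close>, whereas the derivative in the
  direction \<open>(1,-1)\<close> of norm \<open>1\<close> is \<open>182/5\<close>.
\<close>

section \<open>The norm topology\<close>

lemma Metric_space_norm:
  assumes "normed_space_on V N"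
  shows "Metric_space V (\<lambda>x y. if x \<in> V \<and> y \<in> V then N (x - y) else 0)"
proof -
  have V: "subspace V" and pos: "\<And>x. x \<in> V \<Longrightarrow> 0 \<le> N x \<and> (N x = 0 \<longleftrightarrow> x = 0)"
    and sc: "\<And>c x. x \<in> V \<Longrightarrow> N (c *\<^sub>R x) = \<bar>c\<bar> * N x"
    and tri: "\<And>x y. x \<in> V \<Longrightarrow> y \<in> V \<Longrightarrow> N (x + y) \<le> N x + N y"
    using assms by (auto simp: normed_space_on_def)
  have diff: "x - y \<in> V" if "x \<in> V" "y \<in> V" for x y
    using V that by (rule subspace_diff)
  have sym: "N (x - y) = N (y - x)" if "x \<in> V" "y \<in> V" for x y
    using sc[OF diff[OF that], of "-1"] by simp
  have "N (x - z) \<le> N (x - y) + N (y - z)" if "x \<in> V" "y \<in> V" "z \<in> V" for x y z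
    using tri[OF diff[OF that(1,2)] diff[OF that(2,3)]] by simp
  then show ?thesis
    using pos diff sym by unfold_locales auto
qed

lemma topspace_norm_topology:
  assumes "normed_space_on V N"
  shows "topspace (norm_topology V N) = V"
  using Metric_space.topspace_mtopology[OF Metric_space_norm[OF assms]]
  by (simp add: norm_topology_def)

lemma openin_norm_topology:
  assumes "normed_space_on V N"
  shows "openin (norm_topology V N) U \<longleftrightarrow>
    U \<subseteq> V \<and> (\<forall>x\<in>U. \<exists>r>0. \<forall>y\<in>V. N (x - y) < r \<longrightarrow> y \<in> U)"
proof -
  interpret Metric_space V "\<lambda>x y. if x \<in> V \<and> y \<in> V then N (x - y) else 0"
    by (rule Metric_space_norm[OF assms])
  show ?thesis
    unfolding norm_topology_def openin_mtopology mball_def by (rule conj_cong) (auto 0 4)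
qed

lemma continuous_map_functional:
  assumes "normed_space_on V N" "continuous_functional V N f"
  shows "continuous_map (norm_topology V N) euclideanreal f"
proof -
  obtain B where B: "\<And>x. x \<in> V \<Longrightarrow> \<bar>f x\<bar> \<le> B * N x"
    using assms(2) unfolding continuous_functional_def by blast
  have V: "subspace V" and pos: "\<And>x. x \<in> V \<Longrightarrow> 0 \<le> N x"
    using assms(1) by (auto simp: normed_space_on_def)
  have dif: "f (x - y) = f x - f y" if "x \<in> V" "y \<in> V" for x y
  proof -
    have "f (x - y) + f y = f (x - y + y)"
      using assms(2) subspace_diff[OF V that] that(2)
      unfolding continuous_functional_def by metis
    then show ?thesis by simp
  qed
  show ?thesis
    unfolding continuous_map openin_norm_topology[OF assms(1)] topspace_norm_topology[OF assms(1)]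
  proof (intro conjI allI impI ballI)
    fix U x assume "openin euclideanreal U" and x: "x \<in> {x \<in> V. f x \<in> U}"
    then obtain e where e: "e > 0" "\<And>y. \<bar>y - f x\<bar> < e \<Longrightarrow> y \<in> U"
      by (auto simp: open_dist dist_real_def)
    \<comment> \<open>The bound \<open>B\<close> may be zero or negative, so the radius is built
      from the strictly positive Lipschitz constant \<open>\<bar>B\<bar> + 1\<close>.\<close>
    have "y \<in> {x \<in> V. f x \<in> U}" if y: "y \<in> V" "N (x - y) < e / (\<bar>B\<bar> + 1)" for y
    proof -
      have xy: "x - y \<in> V"
        using x y V by (simp add: subspace_diff)
      have "\<bar>f y - f x\<bar> \<le> B * N (x - y)"
        using B[OF xy] dif[of x y] x y by (simp add: abs_minus_commute)
      also have "\<dots> \<le> (\<bar>B\<bar> + 1) * N (x - y)"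
        using pos[OF xy] by (intro mult_right_mono) auto
      also have "\<dots> < e"
        using y(2) by (simp add: field_simps add_pos_nonneg)
      finally show ?thesis
        using e(2) y(1) by blast
    qed
    moreover have "e / (\<bar>B\<bar> + 1) > 0"
      using e(1) by (simp add: add_nonneg_pos)
    ultimately show "\<exists>r>0. \<forall>y\<in>V. N (x - y) < r \<longrightarrow> y \<in> {x \<in> V. f x \<in> U}"
      by blast
  qed auto
qed


section \<open>The plane normed by the difference body of a triangle\<close>

text \<open>\<open>f\<close> and \<open>g\<close> are the coordinates dual to \<open>a\<close>,
  \<open>b\<close>. They are linear on the whole ambient type, so computing with them needs no
  membership in the plane.\<close>

locale coordinate_plane =
  fixes a b :: "'v::real_vector" and f g :: "'v \<Rightarrow> real"
  assumes linear_f: "linear f" and linear_g: "linear g"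
    and f_a [simp]: "f a = 1" and f_b [simp]: "f b = 0"
    and g_a [simp]: "g a = 0" and g_b [simp]: "g b = 1"
begin

definition pt :: "real \<Rightarrow> real \<Rightarrow> 'v" where
  "pt s t = s *\<^sub>R a + t *\<^sub>R b"

definition V :: "'v set" where
  "V = span {a, b}"

text \<open>In coordinates the unit ball is the hexagon |s|, |t|, |s + t| <= 1, which is the
  difference body of the triangle.\<close>

definition N :: "'v \<Rightarrow> real" where
  "N v = max (max \<bar>f v\<bar> \<bar>g v\<bar>) \<bar>f v + g v\<bar>"

definition K :: "'v set" where
  "K = {v \<in> V. 0 \<le> f v \<and> 0 \<le> g v \<and> f v + g v \<le> 1}"

lemmas linear_simps [simp] =
  linear_add[OF linear_f] linear_diff[OF linear_f] linear_scale[OF linear_f] linear_0[OF linear_f]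
  linear_add[OF linear_g] linear_diff[OF linear_g] linear_scale[OF linear_g] linear_0[OF linear_g]

lemma f_pt [simp]: "f (pt s t) = s" and g_pt [simp]: "g (pt s t) = t"
  by (simp_all add: pt_def)

lemma subspace_V: "subspace V"
  by (simp add: V_def)

lemma pt_in_V [simp]: "pt s t \<in> V"
  unfolding pt_def V_def by (intro span_add span_scale span_base) auto

lemma V_cases:
  assumes "v \<in> V"
  obtains s t where "v = pt s t"
proof -
  obtain s where "v - s *\<^sub>R a \<in> span {b}"
    using assms by (auto simp: V_def span_insert)
  then obtain t where "v - s *\<^sub>R a = t *\<^sub>R b"
    by (auto simp: span_singleton)
  then have "v = pt s t"
    by (simp add: pt_def algebra_simps)
  then show thesis ..
qed

lemma pt_add: "pt s t + pt s' t' = pt (s + s') (t + t')"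
  and pt_diff: "pt s t - pt s' t' = pt (s - s') (t - t')"
  and pt_scale: "c *\<^sub>R pt s t = pt (c * s) (c * t)"
  by (simp_all add: pt_def algebra_simps)

lemma pt_eq_iff: "pt s t = pt s' t' \<longleftrightarrow> s = s' \<and> t = t'"
  by (metis f_pt g_pt)

lemma N_nonneg: "0 \<le> N v"
  by (simp add: N_def)

lemma abs_f_le: "\<bar>f v\<bar> \<le> N v" and abs_g_le: "\<bar>g v\<bar> \<le> N v" and abs_f_plus_g_le: "\<bar>f v + g v\<bar> \<le> N v"
  by (simp_all add: N_def)

lemma N_scale: "N (c *\<^sub>R v) = \<bar>c\<bar> * N v"
proof -
  have "\<bar>c * f v + c * g v\<bar> = \<bar>c\<bar> * \<bar>f v + g v\<bar>"
    by (simp add: abs_mult flip: distrib_left)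
  then show ?thesis
    by (simp add: N_def abs_mult max_mult_distrib_left)
qed

lemma normed_plane: "normed_space_on V N"
  unfolding normed_space_on_def
proof (intro conjI ballI allI)
  fix x assume x: "x \<in> V"
  show "(N x = 0) = (x = 0)"
  proof
    assume "N x = 0"
    then have "f x = 0" "g x = 0"
      using abs_f_le[of x] abs_g_le[of x] by auto
    then show "x = 0"
      using x by (elim V_cases) (simp add: pt_def)
  qed (simp add: N_def)
next
  fix x y
  show "N (x + y) \<le> N x + N y"
    using abs_f_le[of x] abs_f_le[of y] abs_g_le[of x] abs_g_le[of y]
      abs_f_plus_g_le[of x] abs_f_plus_g_le[of y]
    unfolding N_def[of "x + y"] by (simp add: abs_le_iff)
qed (auto simp: subspace_V N_nonneg N_scale)

lemmas topspace_plane = topspace_norm_topology[OF normed_plane]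
lemmas openin_plane = openin_norm_topology[OF normed_plane]

lemma N_zero_iff: "x \<in> V \<Longrightarrow> N x = 0 \<longleftrightarrow> x = 0"
  using normed_plane by (auto simp: normed_space_on_def)

lemma continuous_functional_f: "continuous_functional V N f"
  unfolding continuous_functional_def using abs_f_le by (auto intro!: exI[of _ 1])

lemma continuous_functional_g: "continuous_functional V N g"
  unfolding continuous_functional_def using abs_g_le by (auto intro!: exI[of _ 1])

lemma continuous_map_f: "continuous_map (norm_topology V N) euclideanreal f"
  and continuous_map_g: "continuous_map (norm_topology V N) euclideanreal g"
  by (rule continuous_map_functional[OF normed_plane] continuous_functional_f continuous_functional_g)+

section \<open>Closedness, interior and frontier of the triangle\<close>

lemma closedin_K: "closedin (norm_topology V N) K"
proof -
  have "closedin (norm_topology V N)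
      ({v \<in> V. f v \<in> {0..}} \<inter> {v \<in> V. g v \<in> {0..}} \<inter> {v \<in> V. f v + g v \<in> {..1}})"
    using continuous_map_f continuous_map_g continuous_map_add[OF continuous_map_f continuous_map_g]
    by (intro closedin_Int; subst topspace_plane[symmetric];
        intro closedin_continuous_map_preimage[of _ euclideanreal]) auto
  also have "({v \<in> V. f v \<in> {0..}} \<inter> {v \<in> V. g v \<in> {0..}} \<inter> {v \<in> V. f v + g v \<in> {..1}}) = K"
    by (auto simp: K_def)
  finally show ?thesis .
qed

lemma open_triangle_subset_interior:
  "{v \<in> V. 0 < f v \<and> 0 < g v \<and> f v + g v < 1} \<subseteq> norm_topology V N interior_of K"
proof -
  have "openin (norm_topology V N)
      ({v \<in> V. f v \<in> {0<..}} \<inter> {v \<in> V. g v \<in> {0<..}} \<inter> {v \<in> V. f v + g v \<in> {..<1}})"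
    using continuous_map_f continuous_map_g continuous_map_add[OF continuous_map_f continuous_map_g]
    by (intro openin_Int; subst topspace_plane[symmetric];
        intro openin_continuous_map_preimage[of _ euclideanreal]) auto
  also have "({v \<in> V. f v \<in> {0<..}} \<inter> {v \<in> V. g v \<in> {0<..}} \<inter> {v \<in> V. f v + g v \<in> {..<1}}) =
      {v \<in> V. 0 < f v \<and> 0 < g v \<and> f v + g v < 1}"
    by auto
  finally show ?thesis
    by (rule interior_of_maximal[rotated]) (auto simp: K_def)
qed

lemma frontier_K_subset:
  "norm_topology V N frontier_of K \<subseteq> {v \<in> K. f v = 0 \<or> g v = 0 \<or> f v + g v = 1}"
  using open_triangle_subset_interior closure_of_closedin[OF closedin_K]
  by (fastforce simp: frontier_of_def K_def)

text \<open>A small move in the direction -(a + b) makes the vanishing coordinate negative and so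
  leaves \<open>K\<close>. The two legs suffice because the chord exhibited in
  \<open>gamma_body_x\<^sub>0\<close> ends on them.\<close>

lemma in_frontier_K:
  assumes "v \<in> K" "f v = 0 \<or> g v = 0"
  shows "v \<in> norm_topology V N frontier_of K"
proof -
  have "v \<notin> norm_topology V N interior_of K"
  proof
    assume "v \<in> norm_topology V N interior_of K"
    then obtain r where r: "r > 0" "\<And>y. y \<in> V \<Longrightarrow> N (v - y) < r \<Longrightarrow> y \<in> K"
      using openin_interior_of[of "norm_topology V N" K] interior_of_subset[of "norm_topology V N" K]
      unfolding openin_plane by blast
    obtain s t where v: "v = pt s t"
      using assms(1) by (auto simp: K_def elim: V_cases)
    \<comment> \<open>The displacement (r/3, r/3) has norm 2r/3 < r, the sum of the coordinates
      being the largest of the three terms.\<close>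
    have "pt (s - r/3) (t - r/3) \<in> K"
      using r(1) by (intro r(2)) (auto simp: v pt_diff N_def)
    then show False
      using assms(2) r(1) by (auto simp: v K_def)
  qed
  then show ?thesis
    using assms(1) closure_of_closedin[OF closedin_K] by (simp add: frontier_of_def)
qed

lemma convex_body_K: "convex_body_on V N K"
  unfolding convex_body_on_def
proof (intro conjI)
  show "\<exists>B. \<forall>x\<in>K. N x \<le> B"
    by (intro exI[of _ 1]) (auto simp: K_def N_def)
  show "convex K"
  proof (rule convexI)
    fix x y and u w :: real assume "x \<in> K" "y \<in> K" and uw: "0 \<le> u" "0 \<le> w" "u + w = 1"
    then have xy: "x \<in> V" "y \<in> V" "0 \<le> f x" "0 \<le> g x" "0 \<le> f y" "0 \<le> g y"
      "f x + g x \<le> 1" "f y + g y \<le> 1"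
      by (auto simp: K_def)
    have "u * (f x + g x) + w * (f y + g y) \<le> 1"
      using convex_bound_le[OF xy(7,8) uw] .
    then show "u *\<^sub>R x + w *\<^sub>R y \<in> K"
      using xy uw subspace_V by (auto simp: K_def algebra_simps subspace_add subspace_scale)
  qed
  show "norm_topology V N interior_of K \<noteq> {}"
    using open_triangle_subset_interior pt_in_V[of "1/3" "1/3"] by fastforce
qed (rule closedin_K)


section \<open>Width and generalized Minkowski functional\<close>

text \<open>A real \<open>SUP\<close> dominates the values only over a set bounded above; the
  continuity bound of the functional supplies this.\<close>

lemma functional_norm_ge:
  assumes "continuous_functional V N \<phi>" "v \<in> V" "N v \<le> 1"
  shows "\<bar>\<phi> v\<bar> \<le> functional_norm V N \<phi>"
proof -
  obtain B where B: "\<And>x. x \<in> V \<Longrightarrow> \<bar>\<phi> x\<bar> \<le> B * N x"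
    using assms(1) unfolding continuous_functional_def by blast
  have "\<bar>\<phi> x\<bar> \<le> \<bar>B\<bar>" if "x \<in> V" "N x \<le> 1" for x
  proof -
    have "B * N x \<le> \<bar>B\<bar> * 1"
      using that(2) by (intro mult_mono) (auto simp: N_nonneg)
    then show ?thesis using B[OF that(1)] by simp
  qed
  then have "bdd_above ((\<lambda>x. \<bar>\<phi> x\<bar>) ` {x \<in> V. N x \<le> 1})"
    by (intro bdd_aboveI[of _ "\<bar>B\<bar>"]) auto
  then show ?thesis
    unfolding functional_norm_def using assms by (intro cSUP_upper) auto
qed

text \<open>Splitting both coordinates into positive and negative parts gives two points of the
  triangle: the coordinate sum of each is 0, |s|, |t| or |s + t|.\<close>

lemma difference_body:
  assumes "v \<in> V" "N v \<le> 1"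
  obtains x y where "x \<in> K" "y \<in> K" "v = x - y"
proof -
  obtain s t where v: "v = pt s t"
    using assms(1) by (elim V_cases)
  have st: "\<bar>s\<bar> \<le> 1" "\<bar>t\<bar> \<le> 1" "\<bar>s + t\<bar> \<le> 1"
    using assms(2) by (auto simp: v N_def)
  show thesis
  proof
    show "pt (max s 0) (max t 0) \<in> K" "pt (max (-s) 0) (max (-t) 0) \<in> K"
      using st by (auto simp: K_def)
    show "v = pt (max s 0) (max t 0) - pt (max (-s) 0) (max (-t) 0)"
      by (auto simp: v pt_diff pt_eq_iff)
  qed
qed

lemma N_diff_K_le: "x \<in> K \<Longrightarrow> y \<in> K \<Longrightarrow> N (x - y) \<le> 1"
  by (auto simp: K_def N_def)

lemma diff_K_in_V: "x \<in> K \<Longrightarrow> y \<in> K \<Longrightarrow> x - y \<in> V"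
  using subspace_V by (auto simp: K_def subspace_diff)

text \<open>The width in the direction of a functional is its supremum over the unit ball K - K,
  hence at least its norm. A lower bound is what counts, since the width stands in the
  denominator.\<close>

lemma minimal_width_ge: "1 \<le> minimal_width V N K"
  unfolding minimal_width_def
proof (rule cInf_greatest)
  \<comment> \<open>The functional \<open>f\<close> witnesses that the infimum is over a nonempty
    set, as \<open>cInf_greatest\<close> demands.\<close>
  have "functional_norm V N f = 1"
  proof (rule antisym)
    show "functional_norm V N f \<le> 1"
      unfolding functional_norm_def using pt_in_V[of 0 0]
      by (intro cSUP_least) (auto intro: order_trans[OF abs_f_le] exI[of _ "pt 0 0"] simp: N_def)
    show "1 \<le> functional_norm V N f"
      using functional_norm_ge[OF continuous_functional_f, of "pt 1 0"] by (simp add: N_def)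
  qed
  then show "{SUP (u, v)\<in>K \<times> K. \<phi> (u - v) | \<phi>.
      continuous_functional V N \<phi> \<and> functional_norm V N \<phi> = 1} \<noteq> {}"
    using continuous_functional_f by blast
next
  fix r assume "r \<in> {SUP (u, v)\<in>K \<times> K. \<phi> (u - v) | \<phi>.
      continuous_functional V N \<phi> \<and> functional_norm V N \<phi> = 1}"
  then obtain \<phi> where r: "r = (SUP (u, v)\<in>K \<times> K. \<phi> (u - v))"
    and \<phi>: "continuous_functional V N \<phi>" "functional_norm V N \<phi> = 1"
    by auto
  have bdd: "bdd_above ((\<lambda>(u, v). \<phi> (u - v)) ` (K \<times> K))"
  proof (rule bdd_aboveI)
    fix q assume "q \<in> (\<lambda>(u, v). \<phi> (u - v)) ` (K \<times> K)"
    then obtain u v where "u \<in> K" "v \<in> K" "q = \<phi> (u - v)" by auto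
    then show "q \<le> 1"
      using functional_norm_ge[OF \<phi>(1), of "u - v"] \<phi>(2) N_diff_K_le diff_K_in_V by fastforce
  qed
  have "functional_norm V N \<phi> \<le> r"
    unfolding functional_norm_def
  proof (rule cSUP_least)
    show "{x \<in> V. N x \<le> 1} \<noteq> {}"
      using normed_plane N_zero_iff[OF subspace_0[OF subspace_V]] subspace_0[OF subspace_V] by force
    fix z assume z: "z \<in> {x \<in> V. N x \<le> 1}"
    then obtain x y where xy: "x \<in> K" "y \<in> K" "z = x - y"
      using difference_body by blast
    \<comment> \<open>Exchanging the two points of the triangle bounds both signs of the value,
      hence its modulus.\<close>
    have "\<phi> (x - y) \<le> r" "\<phi> (y - x) \<le> r"
      unfolding r using xy cSUP_upper[OF _ bdd, of "(x, y)"] cSUP_upper[OF _ bdd, of "(y, x)"] by auto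
    moreover have "\<phi> (y - x) = - \<phi> z"
    proof -
      have "\<phi> ((-1) *\<^sub>R z) = (-1) * \<phi> z"
        using \<phi>(1) z unfolding continuous_functional_def by blast
      then show ?thesis by (simp add: xy)
    qed
    ultimately show "\<bar>\<phi> z\<bar> \<le> r"
      by (simp add: xy abs_le_iff)
  qed
  then show "1 \<le> r"
    using \<phi>(2) by simp
qed

section \<open>Chords through the chosen interior point\<close>

definition x\<^sub>0 :: 'v where
  "x\<^sub>0 = pt (1/10) (1/10)"

lemma x\<^sub>0_in_interior: "x\<^sub>0 \<in> norm_topology V N interior_of K"
  using open_triangle_subset_interior by (force simp: x\<^sub>0_def)

text \<open>Some barycentric coordinate vanishes at \<open>u\<close>, so its value at
  \<open>x\<^sub>0\<close> is \<open>t\<close> times its value at \<open>v\<close>, hence at most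
  \<open>t\<close>. At \<open>x\<^sub>0\<close> the barycentric coordinates are 1/10, 1/10 and
  4/5.\<close>

lemma chord_parameter_ge:
  assumes "u \<in> norm_topology V N frontier_of K" "v \<in> K" "0 \<le> t"
    and x: "x\<^sub>0 = (1 - t) *\<^sub>R u + t *\<^sub>R v"
  shows "1/10 \<le> t"
proof -
  have u: "f u = 0 \<or> g u = 0 \<or> f u + g u = 1"
    using assms(1) frontier_K_subset by auto
  have v: "0 \<le> f v" "0 \<le> g v" "f v + g v \<le> 1"
    using assms(2) by (auto simp: K_def)
  have "f x\<^sub>0 = 1/10" "g x\<^sub>0 = 1/10"
    by (simp_all add: x\<^sub>0_def)
  then have fx: "(1 - t) * f u + t * f v = 1/10" and gx: "(1 - t) * g u + t * g v = 1/10"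
    by (simp_all add: x)
  have sum: "(1 - t) * (f u + g u) + t * (f v + g v) = 1/5"
    using fx gx by (simp add: distrib_left)
  have fv: "t * f v \<le> t * 1" and gv: "t * g v \<le> t * 1" and sv: "0 \<le> t * (f v + g v)"
    using v assms(3) by (intro mult_left_mono mult_nonneg_nonneg; simp)+
  from u show ?thesis
  proof (elim disjE)
    assume "f u = 0" then show ?thesis using fx fv by simp
  next
    assume "g u = 0" then show ?thesis using gx gv by simp
  next
    assume "f u + g u = 1" then show ?thesis using sum sv by simp
  qed
qed

text \<open>The lower bound enters the final estimate; the upper bound keeps 1 - \<gamma>^2
  nonnegative, so that squaring \<open>minkowski_functional\<close> undoes its square root.\<close>

lemma gamma_body_x\<^sub>0: "3/5 \<le> gamma_body V N K x\<^sub>0" "gamma_body V N K x\<^sub>0 \<le> 1"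
proof -
  let ?S = "{2 * sqrt (N (x\<^sub>0 - u) * N (x\<^sub>0 - v)) / N (u - v) | u v.
      u \<in> norm_topology V N frontier_of K \<and> v \<in> norm_topology V N frontier_of K \<and>
      x\<^sub>0 \<in> closed_segment u v}"
  \<comment> \<open>The chord from (1/5, 0) to (0, 1/5) is bisected by \<open>x\<^sub>0\<close>,
    which makes the quotient 1. It serves both for nonemptiness and for the upper bound.\<close>
  have one: "1 \<in> ?S"
  proof -
    have "x\<^sub>0 = (1 - 1/2) *\<^sub>R pt (1/5) 0 + (1/2) *\<^sub>R pt 0 (1/5)"
      by (simp add: x\<^sub>0_def pt_scale pt_add)
    then have "x\<^sub>0 \<in> closed_segment (pt (1/5) 0) (pt 0 (1/5))"
      unfolding in_segment by (intro exI[of _ "1/2"]) auto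
    moreover have "1 = 2 * sqrt (N (x\<^sub>0 - pt (1/5) 0) * N (x\<^sub>0 - pt 0 (1/5))) / N (pt (1/5) 0 - pt 0 (1/5))"
      by (simp add: x\<^sub>0_def pt_diff N_def real_sqrt_divide)
    moreover have "pt (1/5) 0 \<in> norm_topology V N frontier_of K" "pt 0 (1/5) \<in> norm_topology V N frontier_of K"
      by (rule in_frontier_K; simp add: K_def)+
    ultimately show ?thesis
      by blast
  qed
  have ge: "3/5 \<le> q" if "q \<in> ?S" for q
  proof -
    obtain u v where q: "q = 2 * sqrt (N (x\<^sub>0 - u) * N (x\<^sub>0 - v)) / N (u - v)"
      and u: "u \<in> norm_topology V N frontier_of K" and v: "v \<in> norm_topology V N frontier_of K"
      and "x\<^sub>0 \<in> closed_segment u v"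
      using \<open>q \<in> ?S\<close> by auto
    then obtain t where t: "0 \<le> t" "t \<le> 1" and x: "x\<^sub>0 = (1 - t) *\<^sub>R u + t *\<^sub>R v"
      by (auto simp: in_segment)
    have K: "u \<in> K" "v \<in> K"
      using u v frontier_K_subset by auto
    have "1/10 \<le> t"
      using chord_parameter_ge[OF u K(2) t(1) x] .
    moreover have "1/10 \<le> 1 - t"
      using chord_parameter_ge[OF v K(1), of "1 - t"] t(2) x by (simp add: add.commute)
    \<comment> \<open>This product expands to t (1 - t) - 9/100.\<close>
    ultimately have "0 \<le> (t - 1/10) * (9/10 - t)"
      by simp
    then have "(3/10)\<^sup>2 \<le> t * (1 - t)"
      by (simp add: field_simps power2_eq_square)
    then have "3/10 \<le> sqrt (t * (1 - t))"
      by (rule real_le_rsqrt)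
    \<comment> \<open>By homogeneity of the norm the length of the chord cancels. A degenerate chord
      would put \<open>x\<^sub>0\<close> on the frontier.\<close>
    moreover have "q = 2 * sqrt (t * (1 - t))"
    proof -
      have "u \<noteq> v"
      proof
        assume "u = v"
        then have "x\<^sub>0 = u"
          by (simp add: x flip: scaleR_left_distrib)
        then show False
          using u x\<^sub>0_in_interior by (simp add: frontier_of_def)
      qed
      then have "N (u - v) > 0"
        using N_zero_iff[OF diff_K_in_V[OF K]] N_nonneg[of "u - v"] by auto
      moreover have "x\<^sub>0 - u = (- t) *\<^sub>R (u - v)" "x\<^sub>0 - v = (1 - t) *\<^sub>R (u - v)"
        by (simp_all add: x algebra_simps)
      then have "N (x\<^sub>0 - u) * N (x\<^sub>0 - v) = t * (1 - t) * (N (u - v))\<^sup>2"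
        using t by (simp only: N_scale) (simp add: power2_eq_square)
      ultimately show ?thesis
        by (simp add: q real_sqrt_mult)
    qed
    ultimately show ?thesis
      by simp
  qed
  show "3/5 \<le> gamma_body V N K x\<^sub>0"
    unfolding gamma_body_def using one ge by (intro cInf_greatest) blast+
  show "gamma_body V N K x\<^sub>0 \<le> 1"
    unfolding gamma_body_def using one ge by (intro cInf_lower bdd_belowI) blast+
qed


section \<open>A quadratic polynomial violating the inequality\<close>

text \<open>With s = f + g, the quadratic s (24 - 29 s) nearly equioscillates on [0, 1]: its maximum
  is 144/29 at s = 12/29, its minimum -5 at s = 1. It controls \<open>p\<close> because |f - g| <= s
  on the triangle.\<close>

definition p :: "'v \<Rightarrow> real" where
  "p v = (f v - g v) * (24 - 29 * (f v + g v))"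

text \<open>At \<open>x\<^sub>0\<close> the factor f - g vanishes, so only its derivative
  contributes, multiplied by the other factor 24 - 29/5 = 91/5.\<close>

definition Dp :: "'v \<Rightarrow> real" where
  "Dp h = 91/5 * (f h - g h)"

lemma continuous_polynomial_p: "continuous_polynomial V N 2 p"
  unfolding continuous_polynomial_def
proof (intro conjI exI)
  show "continuous_map (norm_topology V N) euclideanreal p"
    unfolding p_def[abs_def]
    by (intro continuous_intros continuous_map_real_mult_left continuous_map_f continuous_map_g) auto
  define L :: "nat \<Rightarrow> (nat \<Rightarrow> 'v) \<Rightarrow> real" where
    "L k m = (if k = 0 then 0 else if k = 1 then 24 * (f (m 0) - g (m 0))
        else -29 * ((f (m 0) - g (m 0)) * (f (m 1) + g (m 1))))" for k m
  show "\<forall>k\<le>2. multilinear_on V k (L k)"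
    by (auto simp: multilinear_on_def L_def algebra_simps)
  show "\<forall>x\<in>V. p x = (\<Sum>k\<le>2. L k (\<lambda>i\<in>{..<k}. x))"
    by (simp add: numeral_2_eq_2 L_def p_def algebra_simps)
qed

lemma frechet_derivative_p: "frechet_derivative_on V N p x\<^sub>0 Dp"
  unfolding frechet_derivative_on_def
proof (intro conjI allI impI)
  have bound: "\<bar>f h - g h\<bar> \<le> 2 * N h" for h
    using abs_f_le[of h] abs_g_le[of h] by (simp add: abs_le_iff)
  show "continuous_functional V N Dp"
    unfolding continuous_functional_def
  proof (intro conjI ballI allI exI)
    show "\<bar>Dp h\<bar> \<le> 182/5 * N h" for h
      using bound[of h] by (simp add: Dp_def abs_mult)
  qed (simp_all add: Dp_def field_simps)
  fix e :: real assume e: "e > 0"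
  \<comment> \<open>The remainder is exactly the quadratic part of \<open>p\<close> at
    \<open>h\<close>, at most 29 * 2 * N(h)^2; hence the radius e / 58.\<close>
  have "\<bar>p (x\<^sub>0 + h) - p x\<^sub>0 - Dp h\<bar> \<le> e * N h" if h: "N h < e / 58" for h
  proof -
    have "p (x\<^sub>0 + h) - p x\<^sub>0 - Dp h = -29 * ((f h - g h) * (f h + g h))"
      by (simp add: p_def Dp_def x\<^sub>0_def algebra_simps)
    then have "\<bar>p (x\<^sub>0 + h) - p x\<^sub>0 - Dp h\<bar> = 29 * (\<bar>f h - g h\<bar> * \<bar>f h + g h\<bar>)"
      by (simp add: abs_mult)
    also have "\<dots> \<le> 29 * (2 * N h * N h)"
      using bound[of h] abs_f_plus_g_le[of h] N_nonneg[of h]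
      by (intro mult_left_mono mult_mono) auto
    also have "\<dots> = (58 * N h) * N h"
      by simp
    also have "\<dots> \<le> e * N h"
      using h N_nonneg[of h] by (intro mult_right_mono) auto
    finally show ?thesis .
  qed
  then show "\<exists>\<delta>>0. \<forall>h\<in>V. N h < \<delta> \<longrightarrow> \<bar>p (x\<^sub>0 + h) - p x\<^sub>0 - Dp h\<bar> \<le> e * N h"
    using e by (intro exI[of _ "e / 58"]) auto
qed

lemma functional_norm_Dp: "182/5 \<le> functional_norm V N Dp"
  using functional_norm_ge[of Dp "pt 1 (-1)"] frechet_derivative_p
  by (simp add: frechet_derivative_on_def N_def Dp_def)

lemma abs_p_le:
  assumes "x \<in> K"
  shows "\<bar>p x\<bar> \<le> 5"
proof -
  define s where "s = f x + g x"
  have s: "0 \<le> s" "s \<le> 1" and d: "\<bar>f x - g x\<bar> \<le> s"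
    using assms by (auto simp: K_def s_def abs_le_iff)
  \<comment> \<open>Completing the square: 5 - s (24 - 29 s) = 29 (s - 12/29)^2 + 1/29.\<close>
  have "0 \<le> 29 * (s - 12/29)\<^sup>2"
    by simp
  then have "s * (24 - 29 * s) \<le> 5"
    by (simp add: power2_eq_square algebra_simps)
  \<comment> \<open>This product equals 5 + s (24 - 29 s).\<close>
  moreover have "0 \<le> (29 * s + 5) * (1 - s)"
    using s by simp
  then have "- (s * (24 - 29 * s)) \<le> 5"
    by (simp add: algebra_simps)
  ultimately have "s * \<bar>24 - 29 * s\<bar> \<le> 5"
    by (cases "24 - 29 * s \<ge> 0") (simp_all add: algebra_simps)
  moreover have "\<bar>p x\<bar> \<le> s * \<bar>24 - 29 * s\<bar>"
    unfolding p_def s_def[symmetric] abs_mult using d by (rule mult_right_mono) simp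
  ultimately show ?thesis
    by linarith
qed

lemma sup_abs_p: "0 \<le> sup_abs K p" "sup_abs K p \<le> 5"
proof -
  have x\<^sub>0: "x\<^sub>0 \<in> K"
    by (simp add: x\<^sub>0_def K_def)
  show "sup_abs K p \<le> 5"
    unfolding sup_abs_def using x\<^sub>0 abs_p_le by (intro cSUP_least) auto
  show "0 \<le> sup_abs K p"
    unfolding sup_abs_def using x\<^sub>0 abs_p_le by (intro cSUP_upper2[where x = x\<^sub>0] bdd_aboveI2) auto
qed

theorem not_revesz_sarantopoulos: "\<not> revesz_sarantopoulos_conjecture TYPE('v)"
proof
  assume "revesz_sarantopoulos_conjecture TYPE('v)"
  then have le: "functional_norm V N Dp \<le> 2 * real 2 * sqrt ((sup_abs K p)\<^sup>2 - (p x\<^sub>0)\<^sup>2) /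
      (minimal_width V N K * sqrt (1 - (minkowski_functional V N K x\<^sub>0)\<^sup>2))"
    unfolding revesz_sarantopoulos_conjecture_def
    using normed_plane convex_body_K x\<^sub>0_in_interior continuous_polynomial_p frechet_derivative_p
    by blast
  have "(gamma_body V N K x\<^sub>0)\<^sup>2 \<le> 1"
    using gamma_body_x\<^sub>0 by (simp add: power_le_one)
  then have \<gamma>: "sqrt (1 - (minkowski_functional V N K x\<^sub>0)\<^sup>2) = gamma_body V N K x\<^sub>0"
    using gamma_body_x\<^sub>0 by (simp add: minkowski_functional_def)
  have "p x\<^sub>0 = 0"
    by (simp add: p_def x\<^sub>0_def)
  then have "functional_norm V N Dp \<le>
      4 * sup_abs K p / (minimal_width V N K * gamma_body V N K x\<^sub>0)"
    using le \<gamma> sup_abs_p(1) by simp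
  \<comment> \<open>The right-hand side is 100/3, which is less than 182/5.\<close>
  also have "\<dots> \<le> 4 * 5 / (1 * (3/5))"
    using sup_abs_p minimal_width_ge gamma_body_x\<^sub>0(1) by (intro frac_le mult_mono) auto
  finally show False
    using functional_norm_Dp by simp
qed

end

section \<open>Realizing the plane in the ambient space\<close>

theorem corollary15:
  assumes "\<not> (\<exists>B :: 'v::real_vector set. finite B \<and> span B = UNIV)"
  shows "\<not> (revesz_sarantopoulos_conjecture TYPE('v) \<and> baran_conjecture)"
proof -
  have not_span: "span B \<noteq> UNIV" if "finite B" for B :: "'v set"
    using assms that by blast
  \<comment> \<open>Since no finite set spans, two independent vectors can be chosen successively;
    their dual functionals then extend linearly to the whole type.\<close>
  obtain b :: 'v where b: "b \<notin> span {}"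
    using not_span[of "{}"] by blast
  obtain a where a: "a \<notin> span {b}"
    using not_span[of "{b}"] by blast
  have ind: "independent {a, b}"
    using a b by (simp add: independent_insert)
  have "a \<noteq> b"
    using a by (auto simp: span_base)
  obtain f :: "'v \<Rightarrow> real" where f: "linear f" "\<forall>x\<in>{a, b}. f x = (if x = a then 1 else 0)"
    using linear_independent_extend[OF ind, of "\<lambda>x. if x = a then 1 else 0"] by auto
  obtain g :: "'v \<Rightarrow> real" where g: "linear g" "\<forall>x\<in>{a, b}. g x = (if x = b then 1 else 0)"
    using linear_independent_extend[OF ind, of "\<lambda>x. if x = b then 1 else 0"] by auto
  interpret coordinate_plane a b f g
    using f g \<open>a \<noteq> b\<close> by (intro coordinate_plane.intro) auto
  show ?thesis
    using not_revesz_sarantopoulos by blast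
qed

end
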